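(* Let $E$ be a finite set of well-formed closed sentences each of which is $\omega$-true (in particular, $E$ may be a single well-formed $\omega$-true sentence). Then the extension of OGA by $E$ yields no contradiction: there is no term $c$ such that both $E\vdash c$ and $E\vdash\neg c$ are derivable in OGA.
   Context: **Syntax.** Terms: $t::=v_i\mid\bot\mid\mathbf 0\mid\mathbf S t\mid t=t\mid\neg t\mid t\lor t\mid\lambda t\mid t\cdot t\mid\mathcal R\mid\mathcal A$ ($v_i$, $i\in\mathbb N$, de Bruijn variables; $\lambda$ is the only binder; application associates to the left). A term is well-formed (wf) if generated by this grammar. $\bot$ is a divergent constant, $\mathcal R$ the primitive recursor, $\mathcal A$ the universal quantifier. Abbreviations: $t\,\mathsf N$ is $t=t$; $t\,\mathsf B$ is $t\lor\neg t$; $t\ne u$ is $\neg(t=u)$; $t\land u$ is $\neg(\neg t\lor\neg u)$; $t\to u$ is $\neg t\lor u$; $\underline n=\mathbf S^n\mathbf 0$. $\uparrow$ shifts all free indices up by one; $b[t]$ is the $\beta$-instance substituting $t$ for the outermost bound variable of $b$; $[v\mapsto s]$ is capture-avoiding substitution for a free variable; $\mathrm{fv}$ is the set of free variables. **Head steps** $\triangleright$: $(\lambda b)\cdot t\triangleright b[t]$; $\mathcal R\cdot g\cdot h\cdot\mathbf 0\triangleright g$; $\mathcal R\cdot g\cdot h\cdot(\mathbf S\underline n)\triangleright h\cdot\underline n\cdot(\mathcal R\cdot g\cdot h\cdot\underline n)$; if $t\triangleright t'$ then $t\cdot u\triangleright t'\cdot u$. **Rules.** Judgments are $\Gamma\vdash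 c$, $\Gamma$ a finite set of wf terms, $c$ a wf term (all terms in rules are wf). A proof is a finite list of judgments each following from earlier entries by one rule; $\Gamma\vdash c$ is derivable if it occurs in a proof. Rules ("$\Rightarrow$" from premises to conclusion, "$\Leftrightarrow$" both directions; $\Gamma$ is the context of a judgment when none is shown): $\Gamma,c\vdash c$; $\Gamma\vdash c\Rightarrow\Gamma,a\vdash c$; $\Gamma\vdash a$ and $\Gamma,a\vdash c\Rightarrow\Gamma\vdash c$; $\Gamma\vdash c\Rightarrow[v\mapsto s]\Gamma\vdash[v\mapsto s]c$; $\vdash a\Leftrightarrow\ \vdash a=\underline1$; $\vdash\neg a\Leftrightarrow\ \vdash a=\underline0$; $\vdash\neg a,\ \vdash a\Rightarrow\ \vdash c$; $\vdash a\Leftrightarrow\ \vdash\neg\neg a$; $\vdash a\Rightarrow\ \vdash a\lor b$; $\vdash b\Rightarrow\ \vdash a\lor b$; $\vdash\neg a,\ \vdash\neg b\Rightarrow\ \vdash\neg(a\lor b)$; $\vdash a\lor b,\ \Gamma,a\vdash c,\ \Gamma,b\vdash c\Rightarrow\ \vdash c$; $\vdash\neg(a\lor b)\Rightarrow\ \vdash\neg a$; $\vdash\neg(a\lor b)\Rightarrow\ \vdash\neg b$; $\vdash a\,\mathsf N\Leftrightarrow\ \vdash a=a$; $\vdash a=b\Rightarrow\ \vdash b=a$; $\vdash a=b,\ \vdash[v\mapsto a]p\Rightarrow\ \vdash[v\mapsto b]p$; $\vdash a\ne b\Rightarrow\ \vdash b\ne a$; $\vdash a\,\mathsf N,\ \vdash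 b\,\mathsf N\Rightarrow\ \vdash(a=b)\,\mathsf B$; $\vdash(a=b)\,\mathsf B\Rightarrow\ \vdash(a\,\mathsf N)\land(b\,\mathsf N)$; $\vdash\mathbf 0\,\mathsf N$; $\vdash a\,\mathsf N\Leftrightarrow\ \vdash(\mathbf S a)\,\mathsf N$; $\vdash a\,\mathsf N\Rightarrow\ \vdash\mathbf S a\ne\mathbf 0$; $\vdash a\ne b\Leftrightarrow\ \vdash\mathbf S a\ne\mathbf S b$; $\vdash\mathbf S a=\mathbf S b\Rightarrow\ \vdash a=b$; $\vdash\bot\,\mathsf N\Rightarrow\ \vdash p$; induction: $\vdash[v_i\mapsto\mathbf 0]c$, $\ v_i\,\mathsf N,c,\Gamma\vdash[v_i\mapsto\mathbf S v_i]c$, $\ \vdash a\,\mathsf N\Rightarrow\ \vdash[v_i\mapsto a]c$ if $v_i\notin\mathrm{fv}(\Gamma)$; conversion, for $c\triangleright c'$: $\vdash c'\Rightarrow\ \vdash c$; $\vdash c\Rightarrow\ \vdash c'$; $\vdash\neg c\Rightarrow\ \vdash\neg c'$; $\vdash c'\,\mathsf N\Rightarrow\ \vdash c=c'$; $\vdash m\,\mathsf N,\ \vdash(h\cdot m\cdot(\mathcal R\cdot g\cdot h\cdot m))\,\mathsf N\Rightarrow\ \vdash\mathcal R\cdot g\cdot h\cdot(\mathbf S m)=h\cdot m\cdot(\mathcal R\cdot g\cdot h\cdot m)$; $v_0\,\mathsf N,\uparrow\Gamma\vdash\uparrow f\cdot v_0\Rightarrow\Gamma\vdash\mathcal A\cdot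 f$; $\vdash\mathcal A\cdot f,\ \vdash a\,\mathsf N\Rightarrow\ \vdash f\cdot a$; $\vdash\neg(f\cdot a),\ \vdash a\,\mathsf N\Rightarrow\ \vdash\neg(\mathcal A\cdot f)$; $\Gamma\vdash\neg(\mathcal A\cdot f)$ and $v_0\,\mathsf N,\neg(\uparrow f\cdot v_0),\uparrow\Gamma\vdash\uparrow c\Rightarrow\Gamma\vdash c$. These are the rules of RGA. OGA has these and the rule ATI: $\Gamma\vdash\mathcal A\cdot(\lambda((\uparrow u\cdot v_0)\,\mathsf B))\Rightarrow\Gamma\vdash(\mathcal A\cdot u)\,\mathsf B$. Derivability in the extension of OGA by $E$ means OGA-derivability from the hypotheses $E$. **$\omega$-truth.** Let $\Downarrow$ be the least relation between closed terms and naturals such that: $\mathbf 0\Downarrow0$; $t\Downarrow n$ implies $\mathbf S t\Downarrow n+1$; if $t\Downarrow m$, $u\Downarrow n$ then $(t=u)\Downarrow1$ when $m=n$ and $(t=u)\Downarrow0$ when $m\ne n$; $t\Downarrow1$ implies $\neg t\Downarrow0$, and $t\Downarrow0$ implies $\neg t\Downarrow1$; $t\lor u\Downarrow1$ if $t\Downarrow1$ or $u\Downarrow1$, and $t\lor u\Downarrow0$ if $t\Downarrow0$ and $u\Downarrow0$; for any finite list of arguments $\vec s$: $b[t]\cdot\vec s\Downarrow n$ implies $(\lambda b)\cdot t\cdot\vec s\Downarrow n$; if $a\Downarrow0$ and $g\cdot\vec s\Downarrow n$ then $\mathcal R\cdot g\cdot h\cdot a\cdot\vec s\Downarrow n$;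 if $a\Downarrow k+1$ and $h\cdot\underline k\cdot(\mathcal R\cdot g\cdot h\cdot\underline k)\cdot\vec s\Downarrow n$ then $\mathcal R\cdot g\cdot h\cdot a\cdot\vec s\Downarrow n$; $\mathcal A\cdot f\Downarrow1$ if $f\cdot\underline k\Downarrow1$ for all $k\in\mathbb N$; $\mathcal A\cdot f\Downarrow0$ if $f\cdot\underline k\Downarrow0$ for some $k$. A closed term $t$ is $\omega$-true if $t\Downarrow1$. *)

theory Defs
  imports Main "HOL-Library.FSet"
begin

text \<open>The datatype is exactly the grammar, so its values are the well-formed terms.\<close>

datatype trm =
    Var nat
  | Bot
  | Zero
  | Succ trm
  | Eq trm trm  (infix "\<^bold>=" 70)
  | Neg trm  ("\<^bold>\<not> _" [75] 75)
  | Disj trm trm  (infixr "\<^bold>\<or>" 65)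
  | Lam trm
  | App trm trm  (infixl "\<bullet>" 100)
  | Rec
  | Forall

abbreviation is_nat :: "trm \<Rightarrow> trm" where
  "is_nat t \<equiv> t \<^bold>= t"

abbreviation is_bool :: "trm \<Rightarrow> trm" where
  "is_bool t \<equiv> t \<^bold>\<or> \<^bold>\<not> t"

abbreviation Neq :: "trm \<Rightarrow> trm \<Rightarrow> trm"  (infix "\<^bold>\<noteq>" 70) where
  "t \<^bold>\<noteq> u \<equiv> \<^bold>\<not> (t \<^bold>= u)"

abbreviation Conj :: "trm \<Rightarrow> trm \<Rightarrow> trm"  (infixr "\<^bold>\<and>" 67) where
  "t \<^bold>\<and> u \<equiv> \<^bold>\<not> (\<^bold>\<not> t \<^bold>\<or> \<^bold>\<not> u)"

definition num :: "nat \<Rightarrow> trm" where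
  "num n = (Succ ^^ n) Zero"

primrec fv :: "trm \<Rightarrow> nat set" where
  "fv (Var i) = {i}"
| "fv Bot = {}"
| "fv Zero = {}"
| "fv (Succ t) = fv t"
| "fv (t \<^bold>= u) = fv t \<union> fv u"
| "fv (\<^bold>\<not> t) = fv t"
| "fv (t \<^bold>\<or> u) = fv t \<union> fv u"
| "fv (Lam b) = {i. Suc i \<in> fv b}"
| "fv (t \<bullet> u) = fv t \<union> fv u"
| "fv Rec = {}"
| "fv Forall = {}"

definition closed_trm :: "trm \<Rightarrow> bool" where
  "closed_trm t \<longleftrightarrow> fv t = {}"

text \<open>Indices below the cutoff \<open>k\<close> are bound; \<open>shift 0\<close> is the shift of all free indices.\<close>

primrec shift :: "nat \<Rightarrow> trm \<Rightarrow> trm" where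
  "shift k (Var i) = (if i < k then Var i else Var (Suc i))"
| "shift k Bot = Bot"
| "shift k Zero = Zero"
| "shift k (Succ t) = Succ (shift k t)"
| "shift k (t \<^bold>= u) = (shift k t \<^bold>= shift k u)"
| "shift k (\<^bold>\<not> t) = \<^bold>\<not> (shift k t)"
| "shift k (t \<^bold>\<or> u) = (shift k t \<^bold>\<or> shift k u)"
| "shift k (Lam b) = Lam (shift (Suc k) b)"
| "shift k (t \<bullet> u) = shift k t \<bullet> shift k u"
| "shift k Rec = Rec"
| "shift k Forall = Forall"

abbreviation up :: "trm \<Rightarrow> trm"  ("\<up>") where
  "\<up> \<equiv> shift 0"

text \<open>Substitution for a free variable: no other index is renumbered.\<close>

primrec subst :: "nat \<Rightarrow> trm \<Rightarrow> trm \<Rightarrow> trm" where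
  "subst i s (Var j) = (if j = i then s else Var j)"
| "subst i s Bot = Bot"
| "subst i s Zero = Zero"
| "subst i s (Succ t) = Succ (subst i s t)"
| "subst i s (t \<^bold>= u) = (subst i s t \<^bold>= subst i s u)"
| "subst i s (\<^bold>\<not> t) = \<^bold>\<not> (subst i s t)"
| "subst i s (t \<^bold>\<or> u) = (subst i s t \<^bold>\<or> subst i s u)"
| "subst i s (Lam b) = Lam (subst (Suc i) (\<up> s) b)"
| "subst i s (t \<bullet> u) = subst i s t \<bullet> subst i s u"
| "subst i s Rec = Rec"
| "subst i s Forall = Forall"

text \<open>
  \<open>inst 0 t b\<close> is the beta-instance \<open>b[t]\<close>: index \<open>0\<close> is replaced by \<open>t\<close>, and the remaining
  free indices of \<open>b\<close> go down by one because the binder disappears.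
\<close>

primrec inst :: "nat \<Rightarrow> trm \<Rightarrow> trm \<Rightarrow> trm" where
  "inst k s (Var j) = (if j < k then Var j else if j = k then s else Var (j - 1))"
| "inst k s Bot = Bot"
| "inst k s Zero = Zero"
| "inst k s (Succ t) = Succ (inst k s t)"
| "inst k s (t \<^bold>= u) = (inst k s t \<^bold>= inst k s u)"
| "inst k s (\<^bold>\<not> t) = \<^bold>\<not> (inst k s t)"
| "inst k s (t \<^bold>\<or> u) = (inst k s t \<^bold>\<or> inst k s u)"
| "inst k s (Lam b) = Lam (inst (Suc k) (\<up> s) b)"
| "inst k s (t \<bullet> u) = inst k s t \<bullet> inst k s u"
| "inst k s Rec = Rec"
| "inst k s Forall = Forall"

inductive head_step :: "trm \<Rightarrow> trm \<Rightarrow> bool"  (infix "\<rhd>" 50) where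
  beta: "Lam b \<bullet> t \<rhd> inst 0 t b"
| rec_zero: "Rec \<bullet> g \<bullet> h \<bullet> Zero \<rhd> g"
| rec_succ: "Rec \<bullet> g \<bullet> h \<bullet> Succ (num n) \<rhd> h \<bullet> num n \<bullet> (Rec \<bullet> g \<bullet> h \<bullet> num n)"
| app: "t \<rhd> t' \<Longrightarrow> t \<bullet> u \<rhd> t' \<bullet> u"

datatype sequent = Sequent "trm fset" trm  (infix "\<turnstile>" 45)

text \<open>
  \<open>rga_rule P J\<close>: the sequent \<open>J\<close> follows from the set \<open>P\<close> of premises by one application of
  a rule of RGA.
\<close>

inductive rga_rule :: "sequent set \<Rightarrow> sequent \<Rightarrow> bool" where
  hyp: "rga_rule {} (finsert c \<Gamma> \<turnstile> c)"
| weaken: "rga_rule {\<Gamma> \<turnstile> c} (finsert a \<Gamma> \<turnstile> c)"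
| cut: "rga_rule {\<Gamma> \<turnstile> a, finsert a \<Gamma> \<turnstile> c} (\<Gamma> \<turnstile> c)"
| subst: "rga_rule {\<Gamma> \<turnstile> c} (subst v s |`| \<Gamma> \<turnstile> subst v s c)"
| true_eqI: "rga_rule {\<Gamma> \<turnstile> a} (\<Gamma> \<turnstile> a \<^bold>= num 1)"
| true_eqE: "rga_rule {\<Gamma> \<turnstile> a \<^bold>= num 1} (\<Gamma> \<turnstile> a)"
| false_eqI: "rga_rule {\<Gamma> \<turnstile> \<^bold>\<not> a} (\<Gamma> \<turnstile> a \<^bold>= num 0)"
| false_eqE: "rga_rule {\<Gamma> \<turnstile> a \<^bold>= num 0} (\<Gamma> \<turnstile> \<^bold>\<not> a)"
| contradiction: "rga_rule {\<Gamma> \<turnstile> \<^bold>\<not> a, \<Gamma> \<turnstile> a} (\<Gamma> \<turnstile> c)"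
| negnegI: "rga_rule {\<Gamma> \<turnstile> a} (\<Gamma> \<turnstile> \<^bold>\<not> (\<^bold>\<not> a))"
| negnegE: "rga_rule {\<Gamma> \<turnstile> \<^bold>\<not> (\<^bold>\<not> a)} (\<Gamma> \<turnstile> a)"
| disjI1: "rga_rule {\<Gamma> \<turnstile> a} (\<Gamma> \<turnstile> a \<^bold>\<or> b)"
| disjI2: "rga_rule {\<Gamma> \<turnstile> b} (\<Gamma> \<turnstile> a \<^bold>\<or> b)"
| neg_disjI: "rga_rule {\<Gamma> \<turnstile> \<^bold>\<not> a, \<Gamma> \<turnstile> \<^bold>\<not> b} (\<Gamma> \<turnstile> \<^bold>\<not> (a \<^bold>\<or> b))"
| disjE: "rga_rule {\<Gamma> \<turnstile> a \<^bold>\<or> b, finsert a \<Gamma> \<turnstile> c, finsert b \<Gamma> \<turnstile> c} (\<Gamma> \<turnstile> c)"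
| neg_disjE1: "rga_rule {\<Gamma> \<turnstile> \<^bold>\<not> (a \<^bold>\<or> b)} (\<Gamma> \<turnstile> \<^bold>\<not> a)"
| neg_disjE2: "rga_rule {\<Gamma> \<turnstile> \<^bold>\<not> (a \<^bold>\<or> b)} (\<Gamma> \<turnstile> \<^bold>\<not> b)"
| is_natD: "rga_rule {\<Gamma> \<turnstile> is_nat a} (\<Gamma> \<turnstile> a \<^bold>= a)"
| is_natI: "rga_rule {\<Gamma> \<turnstile> a \<^bold>= a} (\<Gamma> \<turnstile> is_nat a)"
| eq_sym: "rga_rule {\<Gamma> \<turnstile> a \<^bold>= b} (\<Gamma> \<turnstile> b \<^bold>= a)"
| eq_subst: "rga_rule {\<Gamma> \<turnstile> a \<^bold>= b, \<Gamma> \<turnstile> subst v a p} (\<Gamma> \<turnstile> subst v b p)"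
| neq_sym: "rga_rule {\<Gamma> \<turnstile> a \<^bold>\<noteq> b} (\<Gamma> \<turnstile> b \<^bold>\<noteq> a)"
| eq_boolI: "rga_rule {\<Gamma> \<turnstile> is_nat a, \<Gamma> \<turnstile> is_nat b} (\<Gamma> \<turnstile> is_bool (a \<^bold>= b))"
| eq_boolE: "rga_rule {\<Gamma> \<turnstile> is_bool (a \<^bold>= b)} (\<Gamma> \<turnstile> is_nat a \<^bold>\<and> is_nat b)"
| zero_nat: "rga_rule {} (\<Gamma> \<turnstile> is_nat Zero)"
| succ_natI: "rga_rule {\<Gamma> \<turnstile> is_nat a} (\<Gamma> \<turnstile> is_nat (Succ a))"
| succ_natE: "rga_rule {\<Gamma> \<turnstile> is_nat (Succ a)} (\<Gamma> \<turnstile> is_nat a)"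
| succ_neq_zero: "rga_rule {\<Gamma> \<turnstile> is_nat a} (\<Gamma> \<turnstile> Succ a \<^bold>\<noteq> Zero)"
| succ_neqI: "rga_rule {\<Gamma> \<turnstile> a \<^bold>\<noteq> b} (\<Gamma> \<turnstile> Succ a \<^bold>\<noteq> Succ b)"
| succ_neqE: "rga_rule {\<Gamma> \<turnstile> Succ a \<^bold>\<noteq> Succ b} (\<Gamma> \<turnstile> a \<^bold>\<noteq> b)"
| succ_eqE: "rga_rule {\<Gamma> \<turnstile> Succ a \<^bold>= Succ b} (\<Gamma> \<turnstile> a \<^bold>= b)"
| bot_natE: "rga_rule {\<Gamma> \<turnstile> is_nat Bot} (\<Gamma> \<turnstile> p)"
| induction:
    "(\<forall>g |\<in>| \<Gamma>. i \<notin> fv g) \<Longrightarrow>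
     rga_rule
       {\<Gamma> \<turnstile> subst i Zero c,
        finsert (is_nat (Var i)) (finsert c \<Gamma>) \<turnstile> subst i (Succ (Var i)) c,
        \<Gamma> \<turnstile> is_nat a}
       (\<Gamma> \<turnstile> subst i a c)"
| expand: "c \<rhd> c' \<Longrightarrow> rga_rule {\<Gamma> \<turnstile> c'} (\<Gamma> \<turnstile> c)"
| reduce: "c \<rhd> c' \<Longrightarrow> rga_rule {\<Gamma> \<turnstile> c} (\<Gamma> \<turnstile> c')"
| reduce_neg: "c \<rhd> c' \<Longrightarrow> rga_rule {\<Gamma> \<turnstile> \<^bold>\<not> c} (\<Gamma> \<turnstile> \<^bold>\<not> c')"
| convert_eq: "c \<rhd> c' \<Longrightarrow> rga_rule {\<Gamma> \<turnstile> is_nat c'} (\<Gamma> \<turnstile> c \<^bold>= c')"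
| rec_succ_eq:
    "rga_rule
       {\<Gamma> \<turnstile> is_nat m, \<Gamma> \<turnstile> is_nat (h \<bullet> m \<bullet> (Rec \<bullet> g \<bullet> h \<bullet> m))}
       (\<Gamma> \<turnstile> Rec \<bullet> g \<bullet> h \<bullet> Succ m \<^bold>= h \<bullet> m \<bullet> (Rec \<bullet> g \<bullet> h \<bullet> m))"
| forallI:
    "rga_rule {finsert (is_nat (Var 0)) (\<up> |`| \<Gamma>) \<turnstile> \<up> f \<bullet> Var 0} (\<Gamma> \<turnstile> Forall \<bullet> f)"
| forallE: "rga_rule {\<Gamma> \<turnstile> Forall \<bullet> f, \<Gamma> \<turnstile> is_nat a} (\<Gamma> \<turnstile> f \<bullet> a)"
| neg_forallI:
    "rga_rule {\<Gamma> \<turnstile> \<^bold>\<not> (f \<bullet> a), \<Gamma> \<turnstile> is_nat a} (\<Gamma> \<turnstile> \<^bold>\<not> (Forall \<bullet> f))"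
| neg_forallE:
    "rga_rule
       {\<Gamma> \<turnstile> \<^bold>\<not> (Forall \<bullet> f),
        finsert (is_nat (Var 0)) (finsert (\<^bold>\<not> (\<up> f \<bullet> Var 0)) (\<up> |`| \<Gamma>)) \<turnstile> \<up> c}
       (\<Gamma> \<turnstile> c)"

inductive oga_rule :: "sequent set \<Rightarrow> sequent \<Rightarrow> bool" where
  rga: "rga_rule P J \<Longrightarrow> oga_rule P J"
| ati: "oga_rule {\<Gamma> \<turnstile> Forall \<bullet> Lam (is_bool (\<up> u \<bullet> Var 0))} (\<Gamma> \<turnstile> is_bool (Forall \<bullet> u))"

definition oga_proof :: "sequent list \<Rightarrow> bool" where
  "oga_proof Js \<longleftrightarrow> (\<forall>i < length Js. \<exists>P \<subseteq> set (take i Js). oga_rule P (Js ! i))"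

definition oga_derivable :: "sequent \<Rightarrow> bool" where
  "oga_derivable J \<longleftrightarrow> (\<exists>Js. oga_proof Js \<and> J \<in> set Js)"

abbreviation apps :: "trm \<Rightarrow> trm list \<Rightarrow> trm"  (infixl "\<bullet>\<bullet>" 100) where
  "t \<bullet>\<bullet> ss \<equiv> foldl App t ss"

text \<open>
  The clauses are not restricted to closed terms. Every premise of a clause whose conclusion
  is about a closed term is itself about a closed term, so the restriction of this relation to
  closed terms is the least relation on closed terms satisfying the clauses.
\<close>

inductive evals :: "trm \<Rightarrow> nat \<Rightarrow> bool"  (infix "\<Down>" 50) where
  zero: "Zero \<Down> 0"
| succ: "t \<Down> n \<Longrightarrow> Succ t \<Down> n + 1"
| eq_true: "t \<Down> m \<Longrightarrow> u \<Down> n \<Longrightarrow> m = n \<Longrightarrow> (t \<^bold>= u) \<Down> 1"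
| eq_false: "t \<Down> m \<Longrightarrow> u \<Down> n \<Longrightarrow> m \<noteq> n \<Longrightarrow> (t \<^bold>= u) \<Down> 0"
| neg_true: "t \<Down> 1 \<Longrightarrow> \<^bold>\<not> t \<Down> 0"
| neg_false: "t \<Down> 0 \<Longrightarrow> \<^bold>\<not> t \<Down> 1"
| disj_true1: "t \<Down> 1 \<Longrightarrow> t \<^bold>\<or> u \<Down> 1"
| disj_true2: "u \<Down> 1 \<Longrightarrow> t \<^bold>\<or> u \<Down> 1"
| disj_false: "t \<Down> 0 \<Longrightarrow> u \<Down> 0 \<Longrightarrow> t \<^bold>\<or> u \<Down> 0"
| beta: "inst 0 t b \<bullet>\<bullet> ss \<Down> n \<Longrightarrow> Lam b \<bullet> t \<bullet>\<bullet> ss \<Down> n"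
| rec_zero: "a \<Down> 0 \<Longrightarrow> g \<bullet>\<bullet> ss \<Down> n \<Longrightarrow> Rec \<bullet> g \<bullet> h \<bullet> a \<bullet>\<bullet> ss \<Down> n"
| rec_succ:
    "a \<Down> k + 1 \<Longrightarrow> h \<bullet> num k \<bullet> (Rec \<bullet> g \<bullet> h \<bullet> num k) \<bullet>\<bullet> ss \<Down> n \<Longrightarrow>
     Rec \<bullet> g \<bullet> h \<bullet> a \<bullet>\<bullet> ss \<Down> n"
| forall_true: "(\<And>k. f \<bullet> num k \<Down> 1) \<Longrightarrow> Forall \<bullet> f \<Down> 1"
| forall_false: "f \<bullet> num k \<Down> 0 \<Longrightarrow> Forall \<bullet> f \<Down> 0"

definition omega_true :: "trm \<Rightarrow> bool" where
  "omega_true t \<longleftrightarrow> closed_trm t \<and> t \<Down> 1"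

end

theory Submission imports Defs
begin

text \<open>
  Soundness of \<open>\<omega>\<close>-truth: every OGA rule preserves the property that the conclusion evaluates to
  \<open>1\<close> under every substitution that makes all hypotheses evaluate to \<open>1\<close>; since evaluation is
  deterministic, \<open>c\<close> and \<open>\<not> c\<close> cannot both evaluate to \<open>1\<close>. The substitution rule for equality,
  induction and the quantifier rules rest on a replacement property: subterms with equal values may
  be exchanged. It holds because a term with a value has no value once applied to
  arguments, so such a subterm is never used as a function.
\<close>

section \<open>Parallel substitution\<close>

text \<open>Substitution beneath a binder shifts the substituted terms, so its laws rest on laws of
  shifting. Renamings contain every \<open>shift k\<close>, compose, and pass binders, which makes
  those laws provable first.\<close>

primrec rename :: "(nat \<Rightarrow> nat) \<Rightarrow> trm \<Rightarrow> trm" where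
  "rename \<rho> (Var i) = Var (\<rho> i)"
| "rename \<rho> Bot = Bot"
| "rename \<rho> Zero = Zero"
| "rename \<rho> (Succ t) = Succ (rename \<rho> t)"
| "rename \<rho> (t \<^bold>= u) = (rename \<rho> t \<^bold>= rename \<rho> u)"
| "rename \<rho> (\<^bold>\<not> t) = \<^bold>\<not> (rename \<rho> t)"
| "rename \<rho> (t \<^bold>\<or> u) = (rename \<rho> t \<^bold>\<or> rename \<rho> u)"
| "rename \<rho> (Lam b) = Lam (rename (case_nat 0 (Suc \<circ> \<rho>)) b)"
| "rename \<rho> (t \<bullet> u) = rename \<rho> t \<bullet> rename \<rho> u"
| "rename \<rho> Rec = Rec"
| "rename \<rho> Forall = Forall"

definition lift :: "(nat \<Rightarrow> trm) \<Rightarrow> nat \<Rightarrow> trm" where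
  "lift \<sigma> = case_nat (Var 0) (\<up> \<circ> \<sigma>)"

text \<open>One simultaneous substitution covers \<open>subst\<close>, \<open>inst\<close> and
  \<open>shift\<close>, and doubles as the assignment in the semantics of sequents.\<close>

primrec psub :: "(nat \<Rightarrow> trm) \<Rightarrow> trm \<Rightarrow> trm" where
  "psub \<sigma> (Var i) = \<sigma> i"
| "psub \<sigma> Bot = Bot"
| "psub \<sigma> Zero = Zero"
| "psub \<sigma> (Succ t) = Succ (psub \<sigma> t)"
| "psub \<sigma> (t \<^bold>= u) = (psub \<sigma> t \<^bold>= psub \<sigma> u)"
| "psub \<sigma> (\<^bold>\<not> t) = \<^bold>\<not> (psub \<sigma> t)"
| "psub \<sigma> (t \<^bold>\<or> u) = (psub \<sigma> t \<^bold>\<or> psub \<sigma> u)"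
| "psub \<sigma> (Lam b) = Lam (psub (lift \<sigma>) b)"
| "psub \<sigma> (t \<bullet> u) = psub \<sigma> t \<bullet> psub \<sigma> u"
| "psub \<sigma> Rec = Rec"
| "psub \<sigma> Forall = Forall"

section \<open>Composition laws for renamings and substitutions\<close>

lemma shift_eq_rename: "shift k t = rename (\<lambda>i. if i < k then i else Suc i) t"
proof (induction t arbitrary: k)
  case (Lam t)
  have "case_nat 0 (Suc \<circ> (\<lambda>i. if i < k then i else Suc i)) = (\<lambda>i. if i < Suc k then i else Suc i)"
    by (auto split: nat.split)
  with Lam show ?case by simp
qed auto

lemma up_eq_rename: "\<up> = rename Suc"
  by (rule ext) (simp add: shift_eq_rename)

text \<open>First of four composition laws (\<open>rename_rename\<close>,
  \<open>psub_rename\<close>, \<open>rename_psub\<close>, \<open>psub_psub\<close>). The order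
  matters: the \<open>Lam\<close> case of the last two compares lifted substitutions, which needs
  the earlier laws to move a shift past the other map.\<close>

lemma rename_rename: "rename \<rho> (rename \<xi> t) = rename (\<rho> \<circ> \<xi>) t"
proof (induction t arbitrary: \<rho> \<xi>)
  case (Lam t)
  have "case_nat 0 (Suc \<circ> \<rho>) \<circ> case_nat 0 (Suc \<circ> \<xi>) = case_nat 0 (Suc \<circ> (\<rho> \<circ> \<xi>))"
    by (auto split: nat.split)
  with Lam show ?case by (simp only: rename.simps psub.simps)
qed auto

lemma psub_rename: "psub \<sigma> (rename \<xi> t) = psub (\<sigma> \<circ> \<xi>) t"
proof (induction t arbitrary: \<sigma> \<xi>)
  case (Lam t)
  have "lift \<sigma> \<circ> case_nat 0 (Suc \<circ> \<xi>) = lift (\<sigma> \<circ> \<xi>)"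
    by (auto simp: lift_def split: nat.split)
  with Lam show ?case by (simp only: rename.simps psub.simps)
qed auto

lemma rename_psub: "rename \<rho> (psub \<sigma> t) = psub (rename \<rho> \<circ> \<sigma>) t"
proof (induction t arbitrary: \<rho> \<sigma>)
  case (Lam t)
  have "rename (case_nat 0 (Suc \<circ> \<rho>)) \<circ> lift \<sigma> = lift (rename \<rho> \<circ> \<sigma>)"
    by (rule ext)
      (auto simp: lift_def up_eq_rename rename_rename comp_def split: nat.split)
  with Lam show ?case by (simp only: rename.simps psub.simps)
qed auto

lemma psub_up: "psub \<sigma> (\<up> t) = psub (\<sigma> \<circ> Suc) t"
  by (simp add: up_eq_rename psub_rename)

lemma psub_psub: "psub \<tau> (psub \<sigma> t) = psub (psub \<tau> \<circ> \<sigma>) t"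
proof (induction t arbitrary: \<tau> \<sigma>)
  case (Lam t)
  have "psub (lift \<tau>) (lift \<sigma> i) = lift (psub \<tau> \<circ> \<sigma>) i" for i
    by (auto simp: lift_def up_eq_rename psub_rename rename_psub comp_def split: nat.split)
  hence "psub (lift \<tau>) \<circ> lift \<sigma> = lift (psub \<tau> \<circ> \<sigma>)"
    by auto
  with Lam show ?case by (simp only: rename.simps psub.simps)
qed auto

lemma psub_Var [simp]: "psub Var t = t"
proof (induction t)
  case (Lam t)
  have "lift Var = Var"
    by (auto simp: lift_def split: nat.split)
  with Lam show ?case by simp
qed auto

text \<open>This is the semantic content of the side condition of the induction rule: changing the
  value of the induction variable does not affect the context.\<close>

lemma psub_fun_upd_fresh: "i \<notin> fv t \<Longrightarrow> psub (\<sigma>(i := s)) t = psub \<sigma> t"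
proof (induction t arbitrary: i s \<sigma>)
  case (Lam t)
  have "lift (\<sigma>(i := s)) = (lift \<sigma>)(Suc i := \<up> s)"
    by (auto simp: lift_def split: nat.split)
  with Lam show ?case by (simp only: psub.simps fv.simps mem_Collect_eq not_False_eq_True)
qed auto

section \<open>Substitution and instantiation as parallel substitutions\<close>

lemma subst_eq_psub: "subst v s t = psub (Var(v := s)) t"
proof (induction t arbitrary: v s)
  case (Lam t)
  have "lift (Var(v := s)) = Var(Suc v := \<up> s)"
    by (auto simp: lift_def split: nat.split)
  with Lam show ?case by (simp only: psub.simps subst.simps)
qed auto

text \<open>The depth \<open>k\<close> is general so that the induction passes binders;
  beta-instances need only depth 0.\<close>

lemma inst_eq_psub: "inst k s t = psub (\<lambda>j. if j < k then Var j else if j = k then s else Var (j - 1)) t"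
proof (induction t arbitrary: k s)
  case (Lam t)
  have "lift (\<lambda>j. if j < k then Var j else if j = k then s else Var (j - 1)) =
      (\<lambda>j. if j < Suc k then Var j else if j = Suc k then \<up> s else Var (j - 1))"
    by (auto simp: lift_def fun_eq_iff split: nat.split)
  with Lam show ?case by simp
qed auto

lemma inst_0_eq_psub: "inst 0 s t = psub (case_nat s Var) t"
proof -
  have "(\<lambda>j. if j < 0 then Var j else if j = 0 then s else Var (j - 1)) = case_nat s Var"
    by (auto simp: fun_eq_iff split: nat.split)
  then show ?thesis by (simp add: inst_eq_psub)
qed

lemma psub_subst: "psub \<sigma> (subst v s t) = psub (\<sigma>(v := psub \<sigma> s)) t"
proof -
  have "psub \<sigma> \<circ> Var(v := s) = \<sigma>(v := psub \<sigma> s)"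
    by auto
  then show ?thesis by (simp add: subst_eq_psub psub_psub)
qed

text \<open>Both sides are composites of parallel substitutions, so agreement on each index
  suffices. On successors the shift inside \<open>lift\<close> is cancelled by instantiating index
  0.\<close>

lemma psub_inst_0: "psub \<sigma> (inst 0 t b) = inst 0 (psub \<sigma> t) (psub (lift \<sigma>) b)"
proof -
  have "psub (case_nat (psub \<sigma> t) Var) (lift \<sigma> i) = psub \<sigma> (case_nat t Var i)" for i
    by (auto simp: lift_def psub_up comp_def split: nat.split)
  hence "psub (case_nat (psub \<sigma> t) Var) \<circ> lift \<sigma> = psub \<sigma> \<circ> case_nat t Var"
    by auto
  then show ?thesis by (simp add: inst_0_eq_psub psub_psub)
qed

lemma num_0 [simp]: "num 0 = Zero"
  and num_Suc [simp]: "num (Suc n) = Succ (num n)"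
  by (simp_all add: num_def)

lemma psub_num [simp]: "psub \<sigma> (num n) = num n"
  by (induction n) auto

lemma psub_apps: "psub \<sigma> (t \<bullet>\<bullet> ss) = psub \<sigma> t \<bullet>\<bullet> map (psub \<sigma>) ss"
  by (induction ss arbitrary: t) auto

lemma head_step_psub: "c \<rhd> c' \<Longrightarrow> psub \<sigma> c \<rhd> psub \<sigma> c'"
  by (induction rule: head_step.induct)
    (auto simp: psub_inst_0 intro: head_step.intros)

section \<open>Evaluation\<close>

primrec head :: "trm \<Rightarrow> trm" where
  "head (Var i) = Var i"
| "head Bot = Bot"
| "head Zero = Zero"
| "head (Succ t) = Succ t"
| "head (t \<^bold>= u) = (t \<^bold>= u)"
| "head (\<^bold>\<not> t) = \<^bold>\<not> t"
| "head (t \<^bold>\<or> u) = (t \<^bold>\<or> u)"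
| "head (Lam b) = Lam b"
| "head (t \<bullet> u) = head t"
| "head Rec = Rec"
| "head Forall = Forall"

primrec args :: "trm \<Rightarrow> trm list" where
  "args (Var i) = []"
| "args Bot = []"
| "args Zero = []"
| "args (Succ t) = []"
| "args (t \<^bold>= u) = []"
| "args (\<^bold>\<not> t) = []"
| "args (t \<^bold>\<or> u) = []"
| "args (Lam b) = []"
| "args (t \<bullet> u) = args t @ [u]"
| "args Rec = []"
| "args Forall = []"

lemma head_apps [simp]: "head (t \<bullet>\<bullet> ss) = head t"
  by (induction ss arbitrary: t) auto

lemma args_apps [simp]: "args (t \<bullet>\<bullet> ss) = args t @ ss"
  by (induction ss arbitrary: t) auto

lemma evals_num: "num n \<Down> n"
  by (induction n) (auto intro: evals.zero dest: evals.succ)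

text \<open>The clauses for redexes end in \<open>foldl\<close> and do not match a concrete term by
  unification. Expressing the cases through \<open>head\<close> and \<open>args\<close> lets the
  spine select the clause; the first case collects all clauses for terms that are not
  applications.\<close>

lemma evals_spine_cases:
  assumes "t \<Down> n"
  obtains "args t = []" "head t = t"
  | b u ss where "head t = Lam b" "args t = u # ss" "inst 0 u b \<bullet>\<bullet> ss \<Down> n"
  | g h a ss where "head t = Rec" "args t = g # h # a # ss" "a \<Down> 0" "g \<bullet>\<bullet> ss \<Down> n"
  | g h a k ss where "head t = Rec" "args t = g # h # a # ss" "a \<Down> Suc k"
      "h \<bullet> num k \<bullet> (Rec \<bullet> g \<bullet> h \<bullet> num k) \<bullet>\<bullet> ss \<Down> n"
  | f where "t = Forall \<bullet> f" "n = 1" "\<And>k. f \<bullet> num k \<Down> 1"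
  | f k where "t = Forall \<bullet> f" "n = 0" "f \<bullet> num k \<Down> 0"
  using assms by cases auto

section \<open>Inversion of evaluation\<close>

lemma evals_beta_iff: "Lam b \<bullet> t \<bullet>\<bullet> ss \<Down> n \<longleftrightarrow> inst 0 t b \<bullet>\<bullet> ss \<Down> n"
proof
  assume "Lam b \<bullet> t \<bullet>\<bullet> ss \<Down> n"
  then show "inst 0 t b \<bullet>\<bullet> ss \<Down> n"
  proof (cases rule: evals_spine_cases)
    \<comment> \<open>Cases 5 and 6 are the two quantifier clauses, excluded because the head of the
      term is \<open>Lam b\<close> and not \<open>Forall\<close>.\<close>
    case (5 f)
    then have "head (Lam b \<bullet> t \<bullet>\<bullet> ss) = Forall" by (simp only: head.simps)
    then show ?thesis by simp
  next
    case (6 f k)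
    then have "head (Lam b \<bullet> t \<bullet>\<bullet> ss) = Forall" by (simp only: head.simps)
    then show ?thesis by simp
  qed auto
qed (rule evals.beta)

lemma evals_rec_iff:
  "Rec \<bullet> g \<bullet> h \<bullet> a \<bullet>\<bullet> ss \<Down> n \<longleftrightarrow>
    a \<Down> 0 \<and> g \<bullet>\<bullet> ss \<Down> n \<or>
    (\<exists>k. a \<Down> Suc k \<and> h \<bullet> num k \<bullet> (Rec \<bullet> g \<bullet> h \<bullet> num k) \<bullet>\<bullet> ss \<Down> n)"
    (is "?l \<longleftrightarrow> ?r")
proof
  assume ?l
  then show ?r
  proof (cases rule: evals_spine_cases)
    case (5 f)
    then have "head (Rec \<bullet> g \<bullet> h \<bullet> a \<bullet>\<bullet> ss) = Forall" by (simp only: head.simps)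
    then show ?thesis by simp
  next
    case (6 f k)
    then have "head (Rec \<bullet> g \<bullet> h \<bullet> a \<bullet>\<bullet> ss) = Forall" by (simp only: head.simps)
    then show ?thesis by simp
  qed auto
qed (auto intro: evals.rec_zero evals.rec_succ)

text \<open>Only \<open>Lam\<close>, \<open>Rec\<close> and \<open>Forall\<close> can head an
  application that has a value; any other head is stuck once it has an argument.\<close>

lemma not_evals_apps:
  assumes "head t = t" "\<forall>b. t \<noteq> Lam b" "t \<noteq> Rec" "t \<noteq> Forall" "ss \<noteq> []"
  shows "\<not> t \<bullet>\<bullet> ss \<Down> n"
proof
  have head: "head (t \<bullet>\<bullet> ss) = t" using assms(1) by simp
  assume "t \<bullet>\<bullet> ss \<Down> n"
  then show False
    by (cases rule: evals_spine_cases) (use assms head in auto)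
qed

lemma evals_forall_iff:
  "Forall \<bullet> f \<Down> n \<longleftrightarrow> n = 1 \<and> (\<forall>k. f \<bullet> num k \<Down> 1) \<or> n = 0 \<and> (\<exists>k. f \<bullet> num k \<Down> 0)"
  (is "?l \<longleftrightarrow> ?r")
proof
  assume ?l
  then show ?r by (cases rule: evals_spine_cases) auto
next
  assume ?r
  then show ?l using evals.forall_true evals.forall_false by blast
qed

text \<open>The quantifier clauses, unlike those for \<open>Lam\<close> and \<open>Rec\<close>,
  allow no trailing arguments.\<close>

lemma not_evals_forall_apps: "ss \<noteq> [] \<Longrightarrow> \<not> Forall \<bullet> f \<bullet>\<bullet> ss \<Down> n"
proof
  assume ss: "ss \<noteq> []" and "Forall \<bullet> f \<bullet>\<bullet> ss \<Down> n"
  from this(2) show False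
  proof (cases rule: evals_spine_cases)
    case (5 g)
    then have "args (Forall \<bullet> f \<bullet>\<bullet> ss) = [g]" by simp
    with ss show ?thesis by simp
  next
    case (6 g k)
    then have "args (Forall \<bullet> f \<bullet>\<bullet> ss) = [g]" by simp
    with ss show ?thesis by simp
  qed auto
qed

text \<open>Discards the redex clauses when \<open>evals.simps\<close> is unfolded at a term that is
  not an application.\<close>

lemma atom_eq_apps: "args t = [] \<Longrightarrow> t = u \<bullet>\<bullet> ss \<longleftrightarrow> ss = [] \<and> t = u"
  by (metis args_apps append_is_Nil_conv foldl_Nil)

lemma evals_zero_iff: "Zero \<Down> n \<longleftrightarrow> n = 0"
  by (subst evals.simps) (auto simp: atom_eq_apps)

lemma evals_succ_iff: "Succ t \<Down> n \<longleftrightarrow> (\<exists>m. n = Suc m \<and> t \<Down> m)"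
  by (subst evals.simps) (auto simp: atom_eq_apps)

lemma evals_eq_iff:
  "(t \<^bold>= u) \<Down> n \<longleftrightarrow> (\<exists>k m. t \<Down> k \<and> u \<Down> m \<and> n = (if k = m then 1 else 0))"
  by (subst evals.simps) (auto simp: atom_eq_apps)

lemma evals_neg_iff: "\<^bold>\<not> t \<Down> n \<longleftrightarrow> t \<Down> 1 \<and> n = 0 \<or> t \<Down> 0 \<and> n = 1"
  by (subst evals.simps) (auto simp: atom_eq_apps)

lemma evals_disj_iff:
  "(t \<^bold>\<or> u) \<Down> n \<longleftrightarrow> (t \<Down> 1 \<or> u \<Down> 1) \<and> n = 1 \<or> t \<Down> 0 \<and> u \<Down> 0 \<and> n = 0"
  by (subst evals.simps) (auto simp: atom_eq_apps)

lemma not_evals_bot: "\<not> Bot \<Down> n"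
  by (subst evals.simps) (auto simp: atom_eq_apps)

lemma not_evals_Lam: "\<not> Lam b \<Down> n"
  by (subst evals.simps) (auto simp: atom_eq_apps)

lemma not_evals_Rec: "\<not> Rec \<Down> n"
  by (subst evals.simps) (auto simp: atom_eq_apps)

lemma not_evals_Forall: "\<not> Forall \<Down> n"
  by (subst evals.simps) (auto simp: atom_eq_apps)

lemmas evals_simps = evals_zero_iff evals_succ_iff evals_eq_iff evals_neg_iff evals_disj_iff
  evals_beta_iff evals_rec_iff evals_forall_iff not_evals_bot

text \<open>Induction on the first derivation, with the second opened by the inversion equivalences.
  Competing clauses are separated by the induction hypotheses: the recursion argument has one value,
  and neither a disjunct nor an instance of a quantified term can have both values 0 and 1.\<close>

lemma evals_deterministic: "t \<Down> m \<Longrightarrow> t \<Down> n \<Longrightarrow> m = n"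
proof (induction arbitrary: n rule: evals.induct)
  case zero
  from zero.prems show ?case unfolding evals_zero_iff by simp
next
  case (succ t m)
  from succ.prems show ?case unfolding evals_succ_iff using succ.IH by (metis Suc_eq_plus1)
next
  case (eq_true t m u k)
  from eq_true.prems show ?case unfolding evals_eq_iff using eq_true.IH eq_true.hyps
    by (metis zero_neq_one)
next
  case (eq_false t m u k)
  from eq_false.prems show ?case unfolding evals_eq_iff using eq_false.IH eq_false.hyps
    by (metis zero_neq_one)
next
  case (neg_true t)
  from neg_true.prems show ?case unfolding evals_neg_iff using neg_true.IH
    by (metis zero_neq_one)
next
  case (neg_false t)
  from neg_false.prems show ?case unfolding evals_neg_iff using neg_false.IH
    by (metis zero_neq_one)
next
  case (disj_true1 t u)
  from disj_true1.prems show ?case unfolding evals_disj_iff using disj_true1.IH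
    by (metis zero_neq_one)
next
  case (disj_true2 u t)
  from disj_true2.prems show ?case unfolding evals_disj_iff using disj_true2.IH
    by (metis zero_neq_one)
next
  case (disj_false t u)
  from disj_false.prems show ?case unfolding evals_disj_iff using disj_false.IH
    by (metis zero_neq_one)
next
  case (beta t b ss m)
  from beta.prems show ?case unfolding evals_beta_iff by (rule beta.IH)
next
  case (rec_zero a g ss m h)
  from rec_zero.prems show ?case unfolding evals_rec_iff using rec_zero.IH
    by (metis zero_neq_one Suc_eq_plus1 nat.inject nat.simps(3))
next
  case (rec_succ a k h g ss m)
  from rec_succ.prems show ?case unfolding evals_rec_iff using rec_succ.IH
    by (metis zero_neq_one Suc_eq_plus1 nat.inject nat.simps(3))
next
  case (forall_true f)
  from forall_true.prems show ?case unfolding evals_forall_iff using forall_true.IH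
    by (metis zero_neq_one)
next
  case (forall_false f k)
  from forall_false.prems show ?case unfolding evals_forall_iff using forall_false.IH
    by (metis zero_neq_one)
qed

text \<open>For \<open>Lam\<close> and \<open>Rec\<close> the extra arguments join the trailing
  list, and the induction hypothesis on the contractum applies; determinism forces the same branch
  of \<open>Rec\<close>. All other clauses produce terms that are stuck when applied.\<close>

lemma evals_not_function: "t \<Down> m \<Longrightarrow> vs \<noteq> [] \<Longrightarrow> \<not> t \<bullet>\<bullet> vs \<Down> n"
proof (induction rule: evals.induct)
  case (beta t b ss n)
  then show ?case by (metis evals_beta_iff foldl_append)
next
  case (rec_zero a g ss m h)
  then have "\<not> Rec \<bullet> g \<bullet> h \<bullet> a \<bullet>\<bullet> (ss @ vs) \<Down> n"
    unfolding evals_rec_iff by (auto dest: evals_deterministic)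
  then show ?case by simp
next
  case (rec_succ a k h g ss m)
  have "\<not> Rec \<bullet> g \<bullet> h \<bullet> a \<bullet>\<bullet> (ss @ vs) \<Down> n"
    unfolding evals_rec_iff using rec_succ by (auto dest: evals_deterministic)
  then show ?case by simp
qed (simp_all add: not_evals_apps not_evals_forall_apps)

text \<open>No clause gives a variable a value, so an evaluation never inspects a free index and
  survives every substitution.\<close>

lemma evals_psub: "t \<Down> n \<Longrightarrow> psub \<sigma> t \<Down> n"
proof (induction rule: evals.induct)
  case (rec_succ a k h g ss n)
  then show ?case by (auto simp: psub_apps evals_rec_iff)
next
  case (forall_false f k)
  then show ?case by (auto simp: evals_forall_iff)
qed (auto simp: evals_simps psub_apps psub_inst_0)

section \<open>Replacement of subterms with equal values\<close>

text \<open>The least compatible relation containing all pairs with a common value, also beneath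
  binders. Without a transitivity clause, inversion leaves only \<open>val\<close> and the clause of
  the outermost constructor.\<close>

inductive equiv_val :: "trm \<Rightarrow> trm \<Rightarrow> bool"  (infix "\<approx>" 50) where
  val: "a \<Down> m \<Longrightarrow> b \<Down> m \<Longrightarrow> a \<approx> b"
| Var: "Var i \<approx> Var i"
| Bot: "Bot \<approx> Bot"
| Zero: "Zero \<approx> Zero"
| Succ: "t \<approx> t' \<Longrightarrow> Succ t \<approx> Succ t'"
| Eq: "t \<approx> t' \<Longrightarrow> u \<approx> u' \<Longrightarrow> (t \<^bold>= u) \<approx> (t' \<^bold>= u')"
| Neg: "t \<approx> t' \<Longrightarrow> \<^bold>\<not> t \<approx> \<^bold>\<not> t'"
| Disj: "t \<approx> t' \<Longrightarrow> u \<approx> u' \<Longrightarrow> (t \<^bold>\<or> u) \<approx> (t' \<^bold>\<or> u')"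
| Lam: "b \<approx> b' \<Longrightarrow> Lam b \<approx> Lam b'"
| App: "t \<approx> t' \<Longrightarrow> u \<approx> u' \<Longrightarrow> t \<bullet> u \<approx> t' \<bullet> u'"
| Rec: "Rec \<approx> Rec"
| Forall: "Forall \<approx> Forall"

lemma equiv_val_refl: "t \<approx> t"
  by (induction t) (auto intro: equiv_val.intros)

text \<open>Proved before the version with two substitutions, whose \<open>Lam\<close> case needs
  invariance under shifting.\<close>

lemma equiv_val_psub_same: "t \<approx> t' \<Longrightarrow> psub \<sigma> t \<approx> psub \<sigma> t'"
  by (induction arbitrary: \<sigma> rule: equiv_val.induct)
    (auto intro: equiv_val.intros equiv_val_refl dest: evals_psub)

lemma equiv_val_psub: "t \<approx> t' \<Longrightarrow> (\<And>i. \<sigma> i \<approx> \<tau> i) \<Longrightarrow> psub \<sigma> t \<approx> psub \<tau> t'"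
proof (induction arbitrary: \<sigma> \<tau> rule: equiv_val.induct)
  case (Lam b b')
  have "\<up> (\<sigma> i) \<approx> \<up> (\<tau> i)" for i
    \<comment> \<open>\<open>psub (Var \<circ> Suc)\<close> is the shift.\<close>
    using equiv_val_psub_same[OF Lam.prems, of "Var \<circ> Suc" i]
    by (metis comp_id fun.map_comp psub_Var psub_rename rename_psub up_eq_rename)
  then have "lift \<sigma> i \<approx> lift \<tau> i" for i
    by (auto simp: lift_def intro: equiv_val.Var split: nat.split)
  then show ?case by (auto intro: equiv_val.Lam Lam.IH)
qed (auto intro: equiv_val.intros evals_psub)

text \<open>The alternatives record where \<open>val\<close> was used along the spine: at the whole
  term, at a proper prefix, or nowhere above \<open>t\<close>, so that head and arguments are
  related separately. Reverse induction fits because the last argument is outermost.\<close>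

lemma equiv_val_apps_cases:
  assumes "t \<bullet>\<bullet> ss \<approx> t'"
  shows "(\<exists>m. t \<bullet>\<bullet> ss \<Down> m \<and> t' \<Down> m) \<or>
    (\<exists>us vs m. ss = us @ vs \<and> vs \<noteq> [] \<and> t \<bullet>\<bullet> us \<Down> m) \<or>
    (\<exists>h' ss'. t' = h' \<bullet>\<bullet> ss' \<and> t \<approx> h' \<and> list_all2 (\<approx>) ss ss')"
  using assms
proof (induction ss arbitrary: t' rule: rev_induct)
  case Nil
  then show ?case by (metis foldl_Nil list_all2_Nil)
next
  case (snoc s ss)
  from snoc.prems have "t \<bullet>\<bullet> ss \<bullet> s \<approx> t'" by simp
  then show ?case
  proof cases
    case (val m)
    then show ?thesis by auto
  next
    case (App q s')
    from snoc.IH[OF App(2)] consider (val) m where "t \<bullet>\<bullet> ss \<Down> m"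
      | (prefix) us vs m where "ss = us @ vs" "vs \<noteq> []" "t \<bullet>\<bullet> us \<Down> m"
      | (apps) h' ss' where "q = h' \<bullet>\<bullet> ss'" "t \<approx> h'" "list_all2 (\<approx>) ss ss'"
      by blast
    then show ?thesis
    proof cases
      case val
      then show ?thesis by (metis not_Cons_self2)
    next
      case prefix
      then have "ss @ [s] = us @ (vs @ [s]) \<and> vs @ [s] \<noteq> [] \<and> t \<bullet>\<bullet> us \<Down> m" by simp
      then show ?thesis by blast
    next
      case apps
      then have "t' = h' \<bullet>\<bullet> (ss' @ [s']) \<and> t \<approx> h' \<and> list_all2 (\<approx>) (ss @ [s]) (ss' @ [s'])"
        using App by (simp add: list_all2_appendI)
      then show ?thesis by blast
    qed
  qed
qed

lemma equiv_val_apps: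
  "t \<approx> t' \<Longrightarrow> list_all2 (\<approx>) ss ss' \<Longrightarrow> t \<bullet>\<bullet> ss \<approx> t' \<bullet>\<bullet> ss'"
  by (induction ss arbitrary: t t' ss')
    (auto simp: list_all2_Cons1 equiv_val.App)

text \<open>A proper prefix cannot have a value when the whole application has one, by
  \<open>evals_not_function\<close>; this removes the middle alternative.\<close>

lemma equiv_val_evaluated_apps:
  assumes "t \<bullet>\<bullet> ss \<Down> n" "t \<bullet>\<bullet> ss \<approx> t'"
  obtains "t' \<Down> n"
  | h' ss' where "t' = h' \<bullet>\<bullet> ss'" "t \<approx> h'" "list_all2 (\<approx>) ss ss'"
proof -
  have False if "ss = us @ vs" "vs \<noteq> []" "t \<bullet>\<bullet> us \<Down> m" for us vs m
    using evals_not_function[OF that(3,2)] assms(1) that(1) by simp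
  with equiv_val_apps_cases[OF assms(2)] show ?thesis
    using that evals_deterministic[OF assms(1)] by blast
qed

inductive_cases equiv_val_LamE: "Lam b \<approx> t"
inductive_cases equiv_val_RecE: "Rec \<approx> t"
inductive_cases equiv_val_ForallE: "Forall \<approx> t"

text \<open>The replacement property, by induction on the evaluation with \<open>t'\<close>
  arbitrary. If the terms are related by \<open>val\<close>, determinism suffices; otherwise they
  share their outer form, their premises or contracta are again related, and the induction
  hypotheses apply.\<close>

lemma equiv_val_evals: "t \<Down> n \<Longrightarrow> t \<approx> t' \<Longrightarrow> t' \<Down> n"
proof (induction arbitrary: t' rule: evals.induct)
  case zero
  from zero.prems show ?case
    by cases (metis evals_deterministic evals.zero, simp add: evals.zero)
next
  case (succ t n)
  from succ.prems show ?case
    by cases (metis evals_deterministic evals.succ[OF succ.hyps], metis succ.IH succ.hyps evals.succ)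
next
  case (eq_true t m u n)
  from eq_true.prems show ?case
    by cases (metis evals_deterministic evals.eq_true[OF eq_true.hyps], metis eq_true.IH eq_true.hyps evals.eq_true)
next
  case (eq_false t m u n)
  from eq_false.prems show ?case
    by cases (metis evals_deterministic evals.eq_false[OF eq_false.hyps], metis eq_false.IH eq_false.hyps evals.eq_false)
next
  case (neg_true t)
  from neg_true.prems show ?case
    by cases (metis evals_deterministic evals.neg_true[OF neg_true.hyps], metis neg_true.IH neg_true.hyps evals.neg_true)
next
  case (neg_false t)
  from neg_false.prems show ?case
    by cases (metis evals_deterministic evals.neg_false[OF neg_false.hyps], metis neg_false.IH neg_false.hyps evals.neg_false)
next
  case (disj_true1 t u)
  from disj_true1.prems show ?case
    by cases (metis evals_deterministic evals.disj_true1[OF disj_true1.hyps], metis disj_true1.IH disj_true1.hyps evals.disj_true1)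
next
  case (disj_true2 u t)
  from disj_true2.prems show ?case
    by cases (metis evals_deterministic evals.disj_true2[OF disj_true2.hyps], metis disj_true2.IH disj_true2.hyps evals.disj_true2)
next
  case (disj_false t u)
  from disj_false.prems show ?case
    by cases (metis evals_deterministic evals.disj_false[OF disj_false.hyps], metis disj_false.IH disj_false.hyps evals.disj_false)
next
  case (beta t b ss n)
  \<comment> \<open>The spine is split at the bare \<open>Lam b\<close>: it has no value, so its
    partner must be an abstraction too. \<open>Rec\<close> and \<open>Forall\<close> are treated
    alike below.\<close>
  have "Lam b \<bullet>\<bullet> (t # ss) \<Down> n" "Lam b \<bullet>\<bullet> (t # ss) \<approx> t'"
    using beta.hyps beta.prems by (simp_all add: evals_beta_iff)
  then show ?case
  proof (cases rule: equiv_val_evaluated_apps)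
    case (2 h' ss')
    then obtain b' s' rs where *: "h' = Lam b'" "b \<approx> b'" "ss' = s' # rs" "t \<approx> s'"
        "list_all2 (\<approx>) ss rs"
      by (auto elim!: equiv_val_LamE simp: not_evals_Lam list_all2_Cons1)
    have "inst 0 t b \<approx> inst 0 s' b'"
      unfolding inst_0_eq_psub using *
      by (auto intro!: equiv_val_psub intro: equiv_val.Var split: nat.split)
    then have "inst 0 s' b' \<bullet>\<bullet> rs \<Down> n"
      using beta.IH equiv_val_apps * by blast
    then show ?thesis using 2(1) * by (simp add: evals_beta_iff)
  qed
next
  case (rec_zero a g ss n h)
  have "Rec \<bullet>\<bullet> (g # h # a # ss) \<Down> n" "Rec \<bullet>\<bullet> (g # h # a # ss) \<approx> t'"
    using rec_zero.hyps rec_zero.prems by (simp_all add: evals_rec_iff)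
  then show ?case
  proof (cases rule: equiv_val_evaluated_apps)
    case (2 h' ss')
    then obtain g' k' a' rs where *: "t' = Rec \<bullet> g' \<bullet> k' \<bullet> a' \<bullet>\<bullet> rs" "g \<approx> g'" "h \<approx> k'" "a \<approx> a'"
        "list_all2 (\<approx>) ss rs"
      by (auto elim!: equiv_val_RecE simp: not_evals_Rec list_all2_Cons1)
    have "a' \<Down> 0" "g' \<bullet>\<bullet> rs \<Down> n"
      using rec_zero.IH * equiv_val_apps by blast+
    then show ?thesis using * by (simp add: evals_rec_iff)
  qed
next
  case (rec_succ a k h g ss n)
  have "Rec \<bullet>\<bullet> (g # h # a # ss) \<Down> n" "Rec \<bullet>\<bullet> (g # h # a # ss) \<approx> t'"
    using evals.rec_succ[OF rec_succ.hyps] rec_succ.prems by simp_all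
  then show ?case
  proof (cases rule: equiv_val_evaluated_apps)
    case (2 h' ss')
    then obtain g' k' a' rs where *: "t' = Rec \<bullet> g' \<bullet> k' \<bullet> a' \<bullet>\<bullet> rs" "g \<approx> g'" "h \<approx> k'" "a \<approx> a'"
        "list_all2 (\<approx>) ss rs"
      by (auto elim!: equiv_val_RecE simp: not_evals_Rec list_all2_Cons1)
    \<comment> \<open>Recursion continues at the numeral of the value, so both contracta contain the
      same \<open>num k\<close> although \<open>a\<close> and \<open>a'\<close> may differ.\<close>
    have "h \<bullet> num k \<bullet> (Rec \<bullet> g \<bullet> h \<bullet> num k) \<approx> k' \<bullet> num k \<bullet> (Rec \<bullet> g' \<bullet> k' \<bullet> num k)"
      using * by (intro equiv_val.App equiv_val.Rec equiv_val_refl)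
    then have "k' \<bullet> num k \<bullet> (Rec \<bullet> g' \<bullet> k' \<bullet> num k) \<bullet>\<bullet> rs \<Down> n" "a' \<Down> k + 1"
      using rec_succ.IH * equiv_val_apps by blast+
    then show ?thesis using * evals.rec_succ by blast
  qed
next
  case (forall_true f)
  have v: "Forall \<bullet>\<bullet> [f] \<Down> 1" "Forall \<bullet>\<bullet> [f] \<approx> t'"
    using evals.forall_true[OF forall_true.hyps] forall_true.prems by simp_all
  then show ?case
  proof (cases rule: equiv_val_evaluated_apps)
    case (2 h' ss')
    then obtain f' where *: "t' = Forall \<bullet> f'" "f \<approx> f'"
      by (auto elim!: equiv_val_ForallE simp: not_evals_Forall list_all2_Cons1)
    then have "f' \<bullet> num k \<Down> 1" for k
      by (intro forall_true.IH[of k] equiv_val.App equiv_val_refl)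
    then show ?thesis unfolding * by (rule evals.forall_true)
  qed
next
  case (forall_false f k)
  have v: "Forall \<bullet>\<bullet> [f] \<Down> 0" "Forall \<bullet>\<bullet> [f] \<approx> t'"
    using evals.forall_false[OF forall_false.hyps] forall_false.prems by simp_all
  then show ?case
  proof (cases rule: equiv_val_evaluated_apps)
    case (2 h' ss')
    then obtain f' where *: "t' = Forall \<bullet> f'" "f \<approx> f'"
      by (auto elim!: equiv_val_ForallE simp: not_evals_Forall list_all2_Cons1)
    then show ?thesis
      using forall_false.IH[of "f' \<bullet> num k"]
      by (auto intro: evals.forall_false equiv_val.App equiv_val_refl)
  qed
qed

lemma evals_replace:
  assumes "psub (\<sigma>(v := a)) p \<Down> n" "a \<Down> m" "b \<Down> m"
  shows "psub (\<sigma>(v := b)) p \<Down> n"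
  using assms(1)
  by (rule equiv_val_evals)
    (use assms in \<open>auto intro!: equiv_val_psub equiv_val_refl intro: equiv_val.val\<close>)

lemma evals_replace_arg:
  assumes "f \<bullet> a \<Down> n" "a \<Down> m" "b \<Down> m"
  shows "f \<bullet> b \<Down> n"
  using assms equiv_val_evals equiv_val.App equiv_val.val equiv_val_refl by metis

text \<open>Trailing arguments are included so that the \<open>app\<close> case can move its
  argument into the list.\<close>

lemma head_step_evals: "c \<rhd> c' \<Longrightarrow> c \<bullet>\<bullet> ss \<Down> n \<longleftrightarrow> c' \<bullet>\<bullet> ss \<Down> n"
proof (induction arbitrary: ss rule: head_step.induct)
  case (rec_succ g h k)
  have "Succ (num k) \<Down> j \<longleftrightarrow> j = Suc k" for j
    using evals_num[of "Suc k"] evals_deterministic by fastforce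
  then show ?case by (simp add: evals_rec_iff)
next
  case (app t t' u)
  from app.IH[of "u # ss"] show ?case by simp
qed (auto simp: evals_beta_iff evals_rec_iff evals_zero_iff)

section \<open>Soundness\<close>

text \<open>Assignments may send variables to terms without a value, as the substitution rule for
  arbitrary \<open>s\<close> requires. That a variable denotes a number is expressed only by
  hypotheses \<open>is_nat (Var i)\<close>.\<close>

definition satisfies :: "(nat \<Rightarrow> trm) \<Rightarrow> trm \<Rightarrow> bool"  (infix "\<Turnstile>" 45) where
  "\<sigma> \<Turnstile> t \<longleftrightarrow> psub \<sigma> t \<Down> 1"

primrec valid :: "sequent \<Rightarrow> bool" where
  "valid (\<Gamma> \<turnstile> c) \<longleftrightarrow> (\<forall>\<sigma>. (\<forall>g |\<in>| \<Gamma>. \<sigma> \<Turnstile> g) \<longrightarrow> \<sigma> \<Turnstile> c)"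

lemma satisfies_neg: "\<sigma> \<Turnstile> \<^bold>\<not> t \<longleftrightarrow> psub \<sigma> t \<Down> 0"
  by (auto simp: satisfies_def evals_simps)

lemma satisfies_disj: "\<sigma> \<Turnstile> t \<^bold>\<or> u \<longleftrightarrow> \<sigma> \<Turnstile> t \<or> \<sigma> \<Turnstile> u"
  by (auto simp: satisfies_def evals_simps)

lemma satisfies_eq: "\<sigma> \<Turnstile> t \<^bold>= u \<longleftrightarrow> (\<exists>m. psub \<sigma> t \<Down> m \<and> psub \<sigma> u \<Down> m)"
  by (auto simp: satisfies_def evals_simps split: if_splits)

lemma satisfies_eq_num: "\<sigma> \<Turnstile> t \<^bold>= num n \<longleftrightarrow> psub \<sigma> t \<Down> n"
  by (metis evals_deterministic evals_num psub_num satisfies_eq)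

lemma satisfies_eq_1: "\<sigma> \<Turnstile> t \<^bold>= Succ Zero \<longleftrightarrow> \<sigma> \<Turnstile> t"
  using satisfies_eq_num[of \<sigma> t 1] by (simp add: satisfies_def)

lemma satisfies_eq_0: "\<sigma> \<Turnstile> t \<^bold>= Zero \<longleftrightarrow> \<sigma> \<Turnstile> \<^bold>\<not> t"
  using satisfies_eq_num[of \<sigma> t 0] by (simp add: satisfies_neg)

lemma satisfies_neq: "\<sigma> \<Turnstile> t \<^bold>\<noteq> u \<longleftrightarrow> (\<exists>m n. psub \<sigma> t \<Down> m \<and> psub \<sigma> u \<Down> n \<and> m \<noteq> n)"
  by (auto simp: satisfies_neg evals_eq_iff split: if_splits)

lemma satisfies_neq_commute: "\<sigma> \<Turnstile> t \<^bold>\<noteq> u \<longleftrightarrow> \<sigma> \<Turnstile> u \<^bold>\<noteq> t"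
  unfolding satisfies_neq by metis

lemma satisfies_succ_neq_succ: "\<sigma> \<Turnstile> Succ t \<^bold>\<noteq> Succ u \<longleftrightarrow> \<sigma> \<Turnstile> t \<^bold>\<noteq> u"
  unfolding satisfies_neq psub.simps evals_succ_iff by blast

lemma satisfies_succ_neq_zero: "\<sigma> \<Turnstile> Succ t \<^bold>\<noteq> Zero \<longleftrightarrow> \<sigma> \<Turnstile> is_nat t"
  by (auto simp: satisfies_neq satisfies_eq evals_succ_iff evals_zero_iff)

lemma satisfies_is_bool_eq: "\<sigma> \<Turnstile> is_bool (t \<^bold>= u) \<longleftrightarrow> \<sigma> \<Turnstile> is_nat t \<and> \<sigma> \<Turnstile> is_nat u"
  unfolding satisfies_disj satisfies_neq satisfies_eq by blast

lemma satisfies_conj: "\<sigma> \<Turnstile> t \<^bold>\<and> u \<longleftrightarrow> \<sigma> \<Turnstile> t \<and> \<sigma> \<Turnstile> u"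
  by (auto simp: satisfies_def evals_neg_iff evals_disj_iff)

lemma satisfies_subst: "\<sigma> \<Turnstile> subst v s t \<longleftrightarrow> \<sigma>(v := psub \<sigma> s) \<Turnstile> t"
  by (simp add: satisfies_def psub_subst)

lemma satisfies_up: "case_nat s \<sigma> \<Turnstile> \<up> t \<longleftrightarrow> \<sigma> \<Turnstile> t"
  by (simp add: satisfies_def psub_up comp_def)

lemma psub_case_nat_up [simp]: "psub (case_nat s \<sigma>) (\<up> t) = psub \<sigma> t"
  by (simp add: psub_up comp_def)

section \<open>Soundness of the individual rules\<close>

lemma valid_induction:
  assumes fresh: "\<forall>g |\<in>| \<Gamma>. i \<notin> fv g"
    and base: "valid (\<Gamma> \<turnstile> subst i Zero c)"
    and step: "valid (finsert (is_nat (Var i)) (finsert c \<Gamma>) \<turnstile> subst i (Succ (Var i)) c)"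
    and nat: "valid (\<Gamma> \<turnstile> is_nat a)"
  shows "valid (\<Gamma> \<turnstile> subst i a c)"
  unfolding valid.simps
proof (intro allI impI)
  fix \<sigma> assume \<Gamma>: "\<forall>g |\<in>| \<Gamma>. \<sigma> \<Turnstile> g"
  have \<Gamma>_upd: "\<forall>g |\<in>| \<Gamma>. \<sigma>(i := s) \<Turnstile> g" for s
  proof
    fix g assume g: "g |\<in>| \<Gamma>"
    with fresh have "psub (\<sigma>(i := s)) g = psub \<sigma> g"
      by (simp add: psub_fun_upd_fresh)
    with \<Gamma> g show "\<sigma>(i := s) \<Turnstile> g" by (simp add: satisfies_def)
  qed
  \<comment> \<open>Induction over the naturals gives \<open>c\<close> at every numeral; the value
    of \<open>a\<close> then selects the numeral to be replaced by \<open>a\<close>.\<close>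
  have all: "\<sigma>(i := num k) \<Turnstile> c" for k
  proof (induction k)
    case 0
    from base \<Gamma> show ?case
      unfolding valid.simps satisfies_subst psub.simps num_0 by blast
  next
    case (Suc k)
    have "\<sigma>(i := num k) \<Turnstile> is_nat (Var i)"
      using evals_num by (auto simp: satisfies_eq)
    with step \<Gamma>_upd Suc have "\<sigma>(i := num k) \<Turnstile> subst i (Succ (Var i)) c"
      unfolding valid.simps by blast
    then show ?case
      unfolding satisfies_subst psub.simps num_Suc fun_upd_upd fun_upd_same .
  qed
  from nat \<Gamma> obtain m where m: "psub \<sigma> a \<Down> m"
    unfolding valid.simps satisfies_eq by blast
  from evals_replace[OF all[of m, unfolded satisfies_def] evals_num m]
  show "\<sigma> \<Turnstile> subst i a c" unfolding satisfies_subst unfolding satisfies_def .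
qed

lemma valid_eq_subst:
  assumes "valid (\<Gamma> \<turnstile> a \<^bold>= b)" "valid (\<Gamma> \<turnstile> subst v a p)"
  shows "valid (\<Gamma> \<turnstile> subst v b p)"
  unfolding valid.simps satisfies_subst
proof (intro allI impI)
  fix \<sigma> assume \<Gamma>: "\<forall>g |\<in>| \<Gamma>. \<sigma> \<Turnstile> g"
  with assms obtain m where "psub \<sigma> a \<Down> m" "psub \<sigma> b \<Down> m" "\<sigma>(v := psub \<sigma> a) \<Turnstile> p"
    unfolding valid.simps satisfies_subst satisfies_eq by blast
  then show "\<sigma>(v := psub \<sigma> b) \<Turnstile> p"
    unfolding satisfies_def by (blast intro: evals_replace)
qed

lemma head_step_evals_psub:
  assumes "c \<rhd> c'"
  shows "psub \<sigma> c \<Down> n \<longleftrightarrow> psub \<sigma> c' \<Down> n"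
  using head_step_evals[OF head_step_psub[OF assms], where ss = "[]"] by simp

text \<open>Evaluation unfolds recursion at \<open>num k\<close>, while the rule mentions
  \<open>m\<close>; replacing both occurrences of \<open>m\<close> by the numeral of its value
  bridges the gap.\<close>

lemma valid_rec_succ_eq:
  assumes "valid (\<Gamma> \<turnstile> is_nat m)" "valid (\<Gamma> \<turnstile> is_nat (h \<bullet> m \<bullet> (Rec \<bullet> g \<bullet> h \<bullet> m)))"
  shows "valid (\<Gamma> \<turnstile> Rec \<bullet> g \<bullet> h \<bullet> Succ m \<^bold>= h \<bullet> m \<bullet> (Rec \<bullet> g \<bullet> h \<bullet> m))"
  unfolding valid.simps
proof (intro allI impI)
  fix \<sigma> assume \<Gamma>: "\<forall>g |\<in>| \<Gamma>. \<sigma> \<Turnstile> g"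
  let ?g = "psub \<sigma> g" and ?h = "psub \<sigma> h" and ?m = "psub \<sigma> m"
  from assms \<Gamma> obtain k n where k: "?m \<Down> k" and n: "?h \<bullet> ?m \<bullet> (Rec \<bullet> ?g \<bullet> ?h \<bullet> ?m) \<Down> n"
    unfolding valid.simps satisfies_eq psub.simps by blast
  have "?h \<bullet> ?m \<bullet> (Rec \<bullet> ?g \<bullet> ?h \<bullet> ?m) \<approx> ?h \<bullet> num k \<bullet> (Rec \<bullet> ?g \<bullet> ?h \<bullet> num k)"
    by (intro equiv_val.App equiv_val_refl equiv_val.val[OF k evals_num])
  with n have "?h \<bullet> num k \<bullet> (Rec \<bullet> ?g \<bullet> ?h \<bullet> num k) \<Down> n"
    by (rule equiv_val_evals)
  with evals.rec_succ[of "Succ ?m" k ?h ?g "[]" n] evals.succ[OF k]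
  have "Rec \<bullet> ?g \<bullet> ?h \<bullet> Succ ?m \<Down> n"
    by simp
  with n show "\<sigma> \<Turnstile> Rec \<bullet> g \<bullet> h \<bullet> Succ m \<^bold>= h \<bullet> m \<bullet> (Rec \<bullet> g \<bullet> h \<bullet> m)"
    by (auto simp: satisfies_eq)
qed

text \<open>The eigenvariable is assigned each numeral in turn; the shifted context and
  \<open>f\<close> keep their meaning under \<open>\<sigma>\<close>.\<close>

lemma valid_forallI:
  assumes "valid (finsert (is_nat (Var 0)) (\<up> |`| \<Gamma>) \<turnstile> \<up> f \<bullet> Var 0)"
  shows "valid (\<Gamma> \<turnstile> Forall \<bullet> f)"
  unfolding valid.simps
proof (intro allI impI)
  fix \<sigma> assume \<Gamma>: "\<forall>g |\<in>| \<Gamma>. \<sigma> \<Turnstile> g"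
  have "case_nat (num k) \<sigma> \<Turnstile> \<up> f \<bullet> Var 0" for k
    by (rule assms[unfolded valid.simps, rule_format])
      (use \<Gamma> evals_num[of k] in \<open>auto simp: satisfies_eq satisfies_up\<close>)
  then show "\<sigma> \<Turnstile> Forall \<bullet> f"
    by (simp add: satisfies_def evals_forall_iff)
qed

lemma valid_forallE:
  assumes "valid (\<Gamma> \<turnstile> Forall \<bullet> f)" "valid (\<Gamma> \<turnstile> is_nat a)"
  shows "valid (\<Gamma> \<turnstile> f \<bullet> a)"
  unfolding valid.simps
proof (intro allI impI)
  fix \<sigma> assume "\<forall>g |\<in>| \<Gamma>. \<sigma> \<Turnstile> g"
  with assms have "\<sigma> \<Turnstile> Forall \<bullet> f" "\<sigma> \<Turnstile> is_nat a"
    unfolding valid.simps by blast+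
  then obtain m where "psub \<sigma> a \<Down> m" "psub \<sigma> f \<bullet> num m \<Down> 1"
    by (auto simp: satisfies_eq) (auto simp: satisfies_def evals_forall_iff)
  then have "psub \<sigma> f \<bullet> psub \<sigma> a \<Down> 1"
    using evals_replace_arg evals_num by blast
  then show "\<sigma> \<Turnstile> f \<bullet> a" by (simp add: satisfies_def)
qed

lemma valid_neg_forallI:
  assumes "valid (\<Gamma> \<turnstile> \<^bold>\<not> (f \<bullet> a))" "valid (\<Gamma> \<turnstile> is_nat a)"
  shows "valid (\<Gamma> \<turnstile> \<^bold>\<not> (Forall \<bullet> f))"
  unfolding valid.simps
proof (intro allI impI)
  fix \<sigma> assume "\<forall>g |\<in>| \<Gamma>. \<sigma> \<Turnstile> g"
  with assms have "\<sigma> \<Turnstile> \<^bold>\<not> (f \<bullet> a)" "\<sigma> \<Turnstile> is_nat a"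
    unfolding valid.simps by blast+
  then obtain m where "psub \<sigma> a \<Down> m" "psub \<sigma> f \<bullet> psub \<sigma> a \<Down> 0"
    by (auto simp: satisfies_eq satisfies_neg)
  then have "psub \<sigma> f \<bullet> num m \<Down> 0"
    using evals_replace_arg evals_num by blast
  then show "\<sigma> \<Turnstile> \<^bold>\<not> (Forall \<bullet> f)"
    by (auto simp: satisfies_neg intro: evals.forall_false)
qed

text \<open>The value 0 of the quantified term supplies a numeral counterexample, which is assigned
  to the eigenvariable.\<close>

lemma valid_neg_forallE:
  assumes "valid (\<Gamma> \<turnstile> \<^bold>\<not> (Forall \<bullet> f))"
    and "valid (finsert (is_nat (Var 0)) (finsert (\<^bold>\<not> (\<up> f \<bullet> Var 0)) (\<up> |`| \<Gamma>)) \<turnstile> \<up> c)"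
  shows "valid (\<Gamma> \<turnstile> c)"
  unfolding valid.simps
proof (intro allI impI)
  fix \<sigma> assume \<Gamma>: "\<forall>g |\<in>| \<Gamma>. \<sigma> \<Turnstile> g"
  with assms(1) obtain k where "psub \<sigma> f \<bullet> num k \<Down> 0"
    by (auto simp: satisfies_neg evals_forall_iff)
  then have "case_nat (num k) \<sigma> \<Turnstile> \<up> c"
    by (intro assms(2)[unfolded valid.simps, rule_format])
      (use \<Gamma> evals_num[of k] in \<open>auto simp: satisfies_eq satisfies_up satisfies_neg\<close>)
  then show "\<sigma> \<Turnstile> c" by (simp add: satisfies_up)
qed

section \<open>From single rules to whole proofs\<close>

lemma rga_rule_sound: "rga_rule P J \<Longrightarrow> \<forall>J' \<in> P. valid J' \<Longrightarrow> valid J"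
proof (induction rule: rga_rule.induct)
  case (true_eqI \<Gamma> a)
  then show ?case by (simp add: satisfies_eq_1)
next
  case (true_eqE \<Gamma> a)
  then show ?case by (simp add: satisfies_eq_1)
next
  case (false_eqI \<Gamma> a)
  then show ?case by (simp add: satisfies_eq_0)
next
  case (false_eqE \<Gamma> a)
  then show ?case by (simp add: satisfies_eq_0)
next
  \<comment> \<open>By determinism no assignment satisfies the context, so the conclusion holds
    vacuously.\<close>
  case (contradiction \<Gamma> a c)
  then show ?case
    by (auto simp: satisfies_neg) (metis evals_deterministic satisfies_def zero_neq_one)
next
  case (induction \<Gamma> i c a)
  then show ?case by - (rule valid_induction, simp_all del: valid.simps)
next
  case (eq_subst \<Gamma> a b v p)
  then show ?case by - (rule valid_eq_subst[of \<Gamma> a b v p], simp_all del: valid.simps)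
next
  case (rec_succ_eq \<Gamma> m h g)
  then show ?case by - (rule valid_rec_succ_eq, simp_all del: valid.simps)
next
  case (forallI \<Gamma> f)
  then show ?case by - (rule valid_forallI, simp_all del: valid.simps)
next
  case (neg_forallE \<Gamma> f c)
  then show ?case by - (rule valid_neg_forallE[of \<Gamma> f c], simp_all del: valid.simps)
next
  case (forallE \<Gamma> f a)
  then show ?case by - (rule valid_forallE[of \<Gamma> f a], simp_all del: valid.simps)
next
  case (neg_forallI \<Gamma> f a)
  then show ?case by - (rule valid_neg_forallI[of \<Gamma> f a], simp_all del: valid.simps)
next
  case (expand c c' \<Gamma>)
  then show ?case by (simp add: satisfies_def head_step_evals_psub)
next
  case (reduce c c' \<Gamma>)
  then show ?case by (simp add: satisfies_def head_step_evals_psub)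
next
  case (reduce_neg c c' \<Gamma>)
  then show ?case by (simp add: satisfies_neg head_step_evals_psub)
next
  case (convert_eq c c' \<Gamma>)
  then show ?case by (simp add: satisfies_eq head_step_evals_psub)
next
  case (negnegI \<Gamma> a)
  then show ?case by (auto simp: satisfies_def evals_simps)
next
  case (negnegE \<Gamma> a)
  then show ?case by (auto simp: satisfies_def evals_simps)
next
  case (subst \<Gamma> c v s)
  then show ?case by (simp add: satisfies_subst)
next
  case (neq_sym \<Gamma> a b)
  then show ?case by (simp add: satisfies_neq_commute[of _ b])
next
  case (eq_boolI \<Gamma> a b)
  then show ?case by (simp add: satisfies_is_bool_eq)
next
  case (eq_boolE \<Gamma> a b)
  then show ?case by (simp add: satisfies_is_bool_eq satisfies_conj)
next
  case (succ_neq_zero \<Gamma> a)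
  then show ?case by (simp add: satisfies_succ_neq_zero)
next
  case (succ_neqI \<Gamma> a b)
  then show ?case by (simp add: satisfies_succ_neq_succ)
next
  case (succ_neqE \<Gamma> a b)
  then show ?case by (simp add: satisfies_succ_neq_succ)
next
  case (disjE \<Gamma> a b c)
  then show ?case by (auto simp: satisfies_disj)
qed (auto simp: satisfies_disj satisfies_neg satisfies_eq evals_simps)

text \<open>Each instance \<open>u \<bullet> num k\<close> has value 1 or 0. By classical reasoning
  in the metatheory, either all are 1 or some is 0, and either way a quantifier clause gives
  \<open>Forall \<bullet> u\<close> a truth value.\<close>

lemma valid_ati:
  assumes "valid (\<Gamma> \<turnstile> Forall \<bullet> Lam (is_bool (\<up> u \<bullet> Var 0)))"
  shows "valid (\<Gamma> \<turnstile> is_bool (Forall \<bullet> u))"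
  unfolding valid.simps
proof (intro allI impI)
  fix \<sigma> assume "\<forall>g |\<in>| \<Gamma>. \<sigma> \<Turnstile> g"
  with assms have "psub \<sigma> (Lam (is_bool (\<up> u \<bullet> Var 0))) \<bullet> num k \<Down> 1" for k
    by (auto simp: satisfies_def evals_forall_iff)
  \<comment> \<open>Instantiating the bound index undoes the shift of \<open>u\<close>.\<close>
  moreover have "inst 0 (num k) (psub (lift \<sigma>) (is_bool (\<up> u \<bullet> Var 0))) = is_bool (psub \<sigma> u \<bullet> num k)" for k
    unfolding psub_inst_0[of \<sigma> "num k", simplified, symmetric]
    by (simp add: inst_0_eq_psub)
  ultimately have "is_bool (psub \<sigma> u \<bullet> num k) \<Down> 1" for k
    using evals_beta_iff[of _ "num k" "[]"] by (metis foldl_Nil psub.simps(8))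
  then have "psub \<sigma> u \<bullet> num k \<Down> 1 \<or> psub \<sigma> u \<bullet> num k \<Down> 0" for k
    by (fastforce simp: evals_disj_iff evals_neg_iff)
  then show "\<sigma> \<Turnstile> is_bool (Forall \<bullet> u)"
    by (auto simp: satisfies_disj satisfies_neg) (auto simp: satisfies_def evals_forall_iff)
qed

lemma oga_rule_sound: "oga_rule P J \<Longrightarrow> \<forall>J' \<in> P. valid J' \<Longrightarrow> valid J"
  by (induction rule: oga_rule.induct) (auto intro: valid_ati rga_rule_sound simp del: valid.simps)

lemma oga_derivable_sound:
  assumes "oga_derivable J"
  shows "valid J"
proof -
  from assms obtain Js where Js: "oga_proof Js" "J \<in> set Js"
    by (auto simp: oga_derivable_def)
  have "valid (Js ! i)" if "i < length Js" for i
    using that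
  proof (induction i rule: less_induct)
    case (less i)
    with Js(1) obtain P where P: "P \<subseteq> set (take i Js)" "oga_rule P (Js ! i)"
      by (auto simp: oga_proof_def)
    have "\<forall>J' \<in> P. valid J'"
      using P(1) less by (fastforce simp: in_set_conv_nth)
    with P(2) show ?case by (rule oga_rule_sound)
  qed
  with Js(2) show ?thesis by (auto simp: in_set_conv_nth)
qed

theorem theorem6p8:
  fixes E :: "trm fset"
  assumes "\<And>e. e |\<in>| E \<Longrightarrow> closed_trm e"
    and "\<And>e. e |\<in>| E \<Longrightarrow> omega_true e"
  shows "\<not> (\<exists>c. oga_derivable (E \<turnstile> c) \<and> oga_derivable (E \<turnstile> \<^bold>\<not> c))"
proof
  assume "\<exists>c. oga_derivable (E \<turnstile> c) \<and> oga_derivable (E \<turnstile> \<^bold>\<not> c)"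
  then obtain c where "valid (E \<turnstile> c)" "valid (E \<turnstile> \<^bold>\<not> c)"
    by (auto dest: oga_derivable_sound simp del: valid.simps)
  \<comment> \<open>The identity assignment leaves every sentence unchanged, so satisfaction of
    \<open>E\<close> is exactly evaluation to 1.\<close>
  moreover have "\<forall>e |\<in>| E. Var \<Turnstile> e"
    using assms(2) by (auto simp: satisfies_def omega_true_def)
  ultimately have "Var \<Turnstile> c" "Var \<Turnstile> \<^bold>\<not> c"
    unfolding valid.simps by blast+
  then show False
    by (metis evals_deterministic satisfies_def satisfies_neg zero_neq_one)
qed

end
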